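(* Let $\mathcal G$ be a terminating graph with $N_{\mathrm{nt}}$ non-terminal and $N_{\mathrm t}$ terminal nodes, in which each terminal node $j$ has been assigned a positive value $v_j$, let $M$ be its propagation matrix with blocks $$M=\begin{bmatrix} A & B \\ 0 & I \end{bmatrix}$$ (non-terminal nodes numbered first), let $u_{\mathrm t}=(v_j^{-1})_{j\text{ terminal}}$, and let $u_0=\begin{pmatrix} \mathbf 1 \\ u_{\mathrm t} \end{pmatrix}$, where $\mathbf 1$ is the all-ones vector of length $N_{\mathrm{nt}}$. Then $I-A$ is invertible, $\lim_{s\to\infty}M^s$ exists, and $$\lim_{s\to\infty}M^s=\begin{bmatrix} 0 & (I-A)^{-1}B \\ 0 & I \end{bmatrix}.$$ In particular, the limiting reciprocal value vector $u=\lim_{s\to\infty}M^s u_0$ exists, satisfies $Mu=u$, and is strictly positive (every entry is $>0$). Writing $u=\begin{pmatrix} u_{\mathrm{nt}} \\ u_{\mathrm t} \end{pmatrix}$ consistently with the partition of $M$, one has $$u_{\mathrm{nt}}=(I-A)^{-1}B u_{\mathrm t}.$$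
   Context: $\mathcal G=(\mathcal V,\mathcal E)$ is a finite directed graph (at most one edge from $i$ to $j$; loops allowed); $i\to j$ means there is an edge from $i$ to $j$, and $n_i$ is the out-degree of $i$. A node is terminal if its out-degree is $0$. A terminating graph is a connected digraph in which every non-terminal node has a directed path to some terminal node. The propagation matrix $M=(m_{i,j})_{i,j\in\mathcal V}$ is defined by $$m_{i,j}=\begin{cases} 1 & \text{if } i\text{ is terminal and } i=j, \\ 1/2 & \text{if } n_i=1\text{ and } i\to j, \\ 1/n_i & \text{if } n_i\ge2\text{ and } i\to j, \\ 0 & \text{otherwise.} \end{cases}$$ In the block form, $A$ is $N_{\mathrm{nt}}\times N_{\mathrm{nt}}$ and $B$ is $N_{\mathrm{nt}}\times N_{\mathrm t}$. *)

theory Defs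
  imports
    Complex_Main
    "Graph_Theory.Digraph_Component"
    "Jordan_Normal_Form.Gauss_Jordan_Elimination"
begin

definition terminal :: "('a, 'b) pre_digraph \<Rightarrow> 'a \<Rightarrow> bool" where
  "terminal G i \<longleftrightarrow> i \<in> verts G \<and> out_degree G i = 0"

definition non_terminal :: "('a, 'b) pre_digraph \<Rightarrow> 'a \<Rightarrow> bool" where
  "non_terminal G i \<longleftrightarrow> i \<in> verts G \<and> out_degree G i \<noteq> 0"

text \<open>
  Loops are allowed but parallel arcs are not, so \<^const>\<open>out_degree\<close> counts successors.
  The library notion \<^const>\<open>Digraph_Component.connected\<close> is connectedness of the underlying
  undirected graph and includes nonemptiness.
\<close>

locale terminating_graph = fin_digraph G + nomulti_digraph G
  for G :: "('a, 'b) pre_digraph" (structure) +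
  assumes connected: "Digraph_Component.connected G"
    and reaches_terminal: "non_terminal G i \<Longrightarrow> \<exists>j. terminal G j \<and> i \<rightarrow>\<^sup>*\<^bsub>G\<^esub> j"

definition propagation_entry :: "('a, 'b) pre_digraph \<Rightarrow> 'a \<Rightarrow> 'a \<Rightarrow> real" where
  "propagation_entry G i j =
    (if terminal G i \<and> i = j then 1
     else if out_degree G i = 1 \<and> i \<rightarrow>\<^bsub>G\<^esub> j then 1 / 2
     else if out_degree G i \<ge> 2 \<and> i \<rightarrow>\<^bsub>G\<^esub> j then 1 / real (out_degree G i)
     else 0)"

text \<open>
  Matrices in \<^typ>\<open>real mat\<close> are indexed by numbers, so a list of nodes fixes the
  numbering. The full propagation matrix is the case where \<open>xs = ys\<close> enumerates all nodes;
  sublists give its blocks.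
\<close>

definition propagation_mat :: "('a, 'b) pre_digraph \<Rightarrow> 'a list \<Rightarrow> 'a list \<Rightarrow> real mat" where
  "propagation_mat G xs ys =
    mat (length xs) (length ys) (\<lambda>(i, j). propagation_entry G (xs ! i) (ys ! j))"

text \<open>
  \<^typ>\<open>real mat\<close> and \<^typ>\<open>real vec\<close> carry no topology. For fixed finite dimensions the
  usual limit is the entrywise one; fixing the dimensions has to be part of the definition.
\<close>

definition mat_LIMSEQ :: "(nat \<Rightarrow> real mat) \<Rightarrow> real mat \<Rightarrow> bool" where
  "mat_LIMSEQ X L \<longleftrightarrow>
    (\<forall>s. X s \<in> carrier_mat (dim_row L) (dim_col L)) \<and>
    (\<forall>i < dim_row L. \<forall>j < dim_col L. (\<lambda>s. X s $$ (i, j)) \<longlonglongrightarrow> L $$ (i, j))"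

definition vec_LIMSEQ :: "(nat \<Rightarrow> real vec) \<Rightarrow> real vec \<Rightarrow> bool" where
  "vec_LIMSEQ x l \<longleftrightarrow>
    (\<forall>s. x s \<in> carrier_vec (dim_vec l)) \<and>
    (\<forall>i < dim_vec l. (\<lambda>s. x s $ i) \<longlonglongrightarrow> l $ i)"

end

theory Submission
  imports Defs "Jordan_Normal_Form.Determinant"
begin

text \<open>
  Everything rests on a discrete maximum principle: the rows of the propagation matrix sum to at
  most 1, so a function that is subharmonic at the non-terminal nodes and takes a maximal value
  \<open>m \<ge> 0\<close> at a non-terminal node takes the value \<open>m\<close> at all successors of that node; following a
  path one finds \<open>m\<close> at a terminal node. Hence \<open>A x = x\<close> forces \<open>x = 0\<close>, which makes \<open>I - A\<close>
  invertible. The row sums of \<open>A\<^sup>s\<close> decrease to a nonnegative fixed vector of \<open>A\<close>, that is to \<open>0\<close>,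
  and with \<open>X = (I - A)\<^sup>-\<^sup>1 B\<close> the upper right block of \<open>M\<^sup>s\<close> is \<open>X - A\<^sup>s X\<close>. Positivity of the limit
  is the maximum principle for \<open>-u\<close>.
\<close>

section \<open>Propagation weights and the maximum principle on the graph\<close>

context terminating_graph
begin

lemma verts_cases: "i \<in> verts G \<longleftrightarrow> terminal G i \<or> non_terminal G i"
  by (auto simp: terminal_def non_terminal_def)

lemma adj_imp_non_terminal:
  assumes "i \<rightarrow> j"
  shows "non_terminal G i"
proof -
  obtain e where "e \<in> out_arcs G i"
    using assms by (auto simp: arcs_ends_conv)
  then have "out_degree G i \<noteq> 0"
    unfolding out_degree_def using finite_out_arcs[of i] by auto
  then show ?thesis
    using adj_in_verts(1)[OF assms] by (simp add: non_terminal_def)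
qed

lemma propagation_entry_nonneg: "0 \<le> propagation_entry G i j"
  by (simp add: propagation_entry_def)

lemma propagation_entry_pos:
  assumes "i \<rightarrow> j"
  shows "0 < propagation_entry G i j"
  using adj_imp_non_terminal[OF assms] assms
  by (auto simp: propagation_entry_def non_terminal_def)

lemma propagation_entry_terminal:
  assumes "terminal G i"
  shows "propagation_entry G i j = (if i = j then 1 else 0)"
  using assms by (auto simp: propagation_entry_def terminal_def)

lemma card_successors_le: "card {j. i \<rightarrow> j} \<le> out_degree G i"
proof -
  have "{j. i \<rightarrow> j} = head G ` out_arcs G i"
    by (force simp: arcs_ends_conv)
  then show ?thesis
    unfolding out_degree_def by (simp add: card_image_le finite_out_arcs)
qed

text \<open>With d the out-degree, each successor has weight at most 1/d (for d = 1 because 1/2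
  \<le> 1), and there are at most d successors.\<close>

lemma propagation_row_sum_le:
  assumes "non_terminal G i"
  shows "(\<Sum>j\<in>verts G. propagation_entry G i j) \<le> 1"
proof -
  let ?S = "{j. i \<rightarrow> j}" and ?d = "out_degree G i"
  have d: "?d > 0" and nt: "\<not> terminal G i"
    using assms by (auto simp: non_terminal_def terminal_def)
  have "(\<Sum>j\<in>verts G. propagation_entry G i j) = (\<Sum>j\<in>?S. propagation_entry G i j)"
    using adj_in_verts(2) nt
    by (intro sum.mono_neutral_right) (auto simp: propagation_entry_def)
  also have "\<dots> \<le> (\<Sum>j\<in>?S. 1 / real ?d)"
    using nt by (intro sum_mono) (auto simp: propagation_entry_def)
  also have "\<dots> = real (card ?S) / real ?d"
    by simp
  also have "\<dots> \<le> 1"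
    using card_successors_le[of i] d by simp
  finally show ?thesis .
qed

text \<open>The condition \<open>0 \<le> f i\<close> compensates for row sums below 1: lost weight
  pulls the weighted sums towards 0, so only a nonnegative maximum is forced onto the
  successors.\<close>

lemma maximum_principle:
  fixes f :: "'a \<Rightarrow> real"
  assumes sub: "\<And>i. non_terminal G i \<Longrightarrow> f i \<le> (\<Sum>j\<in>verts G. propagation_entry G i j * f j)"
    and i: "i \<in> verts G" "0 \<le> f i"
  shows "\<exists>j. terminal G j \<and> f i \<le> f j"
proof -
  define m where "m = Max (f ` verts G)"
  have le: "f j \<le> m" if "j \<in> verts G" for j
    unfolding m_def using that by simp
  have m0: "0 \<le> m"
    using le[OF i(1)] i(2) by linarith
  have "m \<in> f ` verts G"
    unfolding m_def using i(1) by (intro Max_in) auto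
  then obtain k where k: "k \<in> verts G" "f k = m"
    by auto
  have step: "f y = m" if "x \<rightarrow> y" "f x = m" for x y
  proof (rule ccontr)
    assume "f y \<noteq> m"
    have y: "y \<in> verts G"
      using adj_in_verts(2)[OF that(1)] .
    have nt: "non_terminal G x"
      using adj_imp_non_terminal[OF that(1)] .
    \<comment> \<open>One successor below \<open>m\<close> has positive weight, so the whole
      weighted sum at \<open>x\<close> drops strictly below \<open>m\<close> times the row
      sum.\<close>
    have "f y < m"
      using le[OF y] \<open>f y \<noteq> m\<close> by simp
    then have "(\<Sum>j\<in>verts G. propagation_entry G x j * f j)
        < (\<Sum>j\<in>verts G. propagation_entry G x j * m)"
      using y le propagation_entry_nonneg propagation_entry_pos[OF that(1)]
      by (intro sum_strict_mono_ex1) (auto intro!: mult_left_mono bexI[of _ y])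
    also have "\<dots> = m * (\<Sum>j\<in>verts G. propagation_entry G x j)"
      by (simp add: sum_distrib_left mult.commute)
    also have "\<dots> \<le> m"
      using mult_left_mono[OF propagation_row_sum_le[OF nt] m0] by simp
    finally show False
      using sub[OF nt] that(2) by simp
  qed
  \<comment> \<open>If the maximizer \<open>k\<close> is itself terminal, the empty path
    serves.\<close>
  obtain t where t: "terminal G t" "k \<rightarrow>\<^sup>* t"
    using k(1) reaches_terminal by (metis verts_cases reachable_refl)
  from t(2) have "f t = m"
    by (induction rule: reachable_induct) (use k step in auto)
  then show ?thesis
    using t(1) le[OF i(1)] by auto
qed

end

section \<open>From list positions to nodes\<close>

lemma propagation_mat_carrier [simp]:
  "propagation_mat G xs ys \<in> carrier_mat (length xs) (length ys)"
  "dim_row (propagation_mat G xs ys) = length xs"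
  "dim_col (propagation_mat G xs ys) = length ys"
  by (simp_all add: propagation_mat_def)

lemma index_propagation_mat [simp]:
  "i < length xs \<Longrightarrow> j < length ys \<Longrightarrow>
    propagation_mat G xs ys $$ (i, j) = propagation_entry G (xs ! i) (ys ! j)"
  by (simp add: propagation_mat_def)

lemma sum_nth_distinct:
  assumes "distinct xs"
  shows "(\<Sum>k<length xs. g (xs ! k)) = (\<Sum>a\<in>set xs. g a)"
  using sum.reindex_bij_betw[OF bij_betw_nth[OF assms refl refl]] .

lemma inv_into_nth:
  assumes "distinct xs" "k < length xs"
  shows "inv_into {..<length xs} ((!) xs) (xs ! k) = k"
  using assms by (intro inv_into_f_f) (auto intro: inj_on_nth)

text \<open>Turns matrix products into the node sums of the maximum principle; \<open>f\<close> is
  the vector \<open>x\<close> read as a function on nodes.\<close>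

lemma index_propagation_mat_mult_vec:
  assumes "x \<in> carrier_vec (length ys)" "distinct ys" "k < length xs"
    and "\<And>l. l < length ys \<Longrightarrow> f (ys ! l) = x $ l"
  shows "(propagation_mat G xs ys *\<^sub>v x) $ k =
    (\<Sum>a\<in>set ys. propagation_entry G (xs ! k) a * f a)"
proof -
  have "(propagation_mat G xs ys *\<^sub>v x) $ k =
      (\<Sum>l<length ys. propagation_entry G (xs ! k) (ys ! l) * f (ys ! l))"
    using assms by (simp add: scalar_prod_def lessThan_atLeast0)
  then show ?thesis
    using sum_nth_distinct[OF assms(2), of "\<lambda>a. propagation_entry G (xs ! k) a * f a"] by simp
qed

section \<open>Enumerated nodes and the block form\<close>

locale numbered_terminating_graph = terminating_graph +
  fixes ns ts :: "'a list"
  assumes distinct_ns: "distinct ns" and set_ns: "set ns = {i. non_terminal G i}"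
    and distinct_ts: "distinct ts" and set_ts: "set ts = {j. terminal G j}"
begin

abbreviation "n \<equiv> length ns"
abbreviation "t \<equiv> length ts"
abbreviation "A \<equiv> propagation_mat G ns ns"
abbreviation "B \<equiv> propagation_mat G ns ts"
abbreviation "M \<equiv> propagation_mat G (ns @ ts) (ns @ ts)"

lemma non_terminal_nth: "k < n \<Longrightarrow> non_terminal G (ns ! k)"
  using set_ns nth_mem by blast

lemma terminal_nth: "l < t \<Longrightarrow> terminal G (ts ! l)"
  using set_ts nth_mem by blast

lemma disjoint_lists: "set ns \<inter> set ts = {}"
  unfolding set_ns set_ts by (auto simp: terminal_def non_terminal_def)

lemma verts_lists: "verts G = set ns \<union> set ts"
  unfolding set_ns set_ts using verts_cases by auto

lemma M_blocks: "M = four_block_mat A B (0\<^sub>m t n) (1\<^sub>m t)"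
proof (rule eq_matI)
  fix i j
  assume "i < dim_row (four_block_mat A B (0\<^sub>m t n) (1\<^sub>m t))"
    and "j < dim_col (four_block_mat A B (0\<^sub>m t n) (1\<^sub>m t))"
  then have ij: "i < n + t" "j < n + t"
    by simp_all
  \<comment> \<open>Terminal rows are unit vectors: disjointness of the two lists makes the lower
    left block zero, distinctness of \<open>ts\<close> makes the lower right one the
    identity.\<close>
  have low: "propagation_entry G (ts ! (i - n)) a = (if ts ! (i - n) = a then 1 else 0)"
    if "\<not> i < n" for a
    using that ij by (intro propagation_entry_terminal terminal_nth) auto
  have "ts ! k \<noteq> ns ! l" if "k < t" "l < n" for k l
    using disjoint_lists nth_mem that by (metis disjoint_iff)
  then show "M $$ (i, j) = four_block_mat A B (0\<^sub>m t n) (1\<^sub>m t) $$ (i, j)"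
    using ij low distinct_ts by (auto simp: nth_append nth_eq_iff_index_eq)
qed simp_all

text \<open>Here \<open>x\<close> holds the values at non-terminal nodes and \<open>y\<close> the
  boundary values at terminal nodes; the sum over all nodes splits into the \<open>A\<close> part
  and the \<open>B\<close> part.\<close>

lemma maximum_principle_vec:
  assumes x: "x \<in> carrier_vec n" and y: "y \<in> carrier_vec t"
    and sub: "\<And>k. k < n \<Longrightarrow> x $ k \<le> (A *\<^sub>v x) $ k + (B *\<^sub>v y) $ k"
    and i: "i < n" "0 \<le> x $ i"
  shows "\<exists>l<t. x $ i \<le> y $ l"
proof -
  \<comment> \<open>The inverse of each enumeration recovers the position of a node, which glues
    both vectors into one function on nodes.\<close>
  define f where "f a = (if a \<in> set ns then x $ inv_into {..<n} ((!) ns) a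
                         else y $ inv_into {..<t} ((!) ts) a)" for a
  have fn: "f (ns ! k) = x $ k" if "k < n" for k
    using that by (simp add: f_def inv_into_nth distinct_ns)
  have ft: "f (ts ! l) = y $ l" if "l < t" for l
    using that disjoint_lists by (auto simp: f_def inv_into_nth distinct_ts)
  have "f a \<le> (\<Sum>j\<in>verts G. propagation_entry G a j * f j)" if "non_terminal G a" for a
  proof -
    have "a \<in> set ns"
      using that set_ns by simp
    then obtain k where k: "k < n" "a = ns ! k"
      by (auto simp: in_set_conv_nth)
    have "(\<Sum>j\<in>verts G. propagation_entry G a j * f j) = (A *\<^sub>v x) $ k + (B *\<^sub>v y) $ k"
      using index_propagation_mat_mult_vec[OF x distinct_ns k(1) fn, of G]
        index_propagation_mat_mult_vec[OF y distinct_ts k(1) ft, of G]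
      by (simp add: verts_lists k(2) sum.union_disjoint disjoint_lists)
    then show ?thesis
      using sub[OF k(1)] fn[OF k(1)] k(2) by simp
  qed
  from maximum_principle[of f, OF this, of "ns ! i"]
  obtain j where j: "terminal G j" "x $ i \<le> f j"
    using i fn[OF i(1)] verts_lists by auto
  from j(1) have "j \<in> set ts"
    using set_ts by simp
  then obtain l where "l < t" "j = ts ! l"
    by (auto simp: in_set_conv_nth)
  then show ?thesis
    using j ft by auto
qed

section \<open>Invertibility of I - A\<close>

lemma fixed_vec_eq_0:
  assumes x: "x \<in> carrier_vec n" and Ax: "A *\<^sub>v x = x"
  shows "x = 0\<^sub>v n"
proof -
  have not_pos: "\<not> 0 < y $ k" if y: "y \<in> carrier_vec n" "A *\<^sub>v y = y" and k: "k < n" for y k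
  proof
    assume "0 < y $ k"
    \<comment> \<open>A fixed vector of \<open>A\<close> is harmonic with boundary values zero, so
      no entry can be positive.\<close>
    then have "\<exists>l<t. y $ k \<le> 0\<^sub>v t $ l"
      using y k by (intro maximum_principle_vec) auto
    then show False
      using \<open>0 < y $ k\<close> by auto
  qed
  \<comment> \<open>The negative of a fixed vector is fixed too, so both signs are excluded.\<close>
  have "A *\<^sub>v (- x) = - (A *\<^sub>v x)"
    using x by (intro eq_vecI) auto
  then have "x $ k = 0" if "k < n" for k
    using not_pos[OF x Ax that] not_pos[of "- x" k] x that Ax by force
  then show ?thesis
    using x by auto
qed

text \<open>\<open>mat_inverse\<close> is option-valued; \<open>R_inverse\<close> shows that it does
  not return \<open>None\<close> here, which gives \<open>the\<close> its meaning.\<close>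

definition "R \<equiv> the (mat_inverse (1\<^sub>m n - A))"

text \<open>A zero determinant would yield a nonzero kernel vector of I - A, that is, a nonzero
  fixed vector of \<open>A\<close>.\<close>

lemma R_inverse:
  shows R_carrier: "R \<in> carrier_mat n n"
    and mult_R: "(1\<^sub>m n - A) * R = 1\<^sub>m n"
    and R_mult: "R * (1\<^sub>m n - A) = 1\<^sub>m n"
proof -
  have c: "1\<^sub>m n - A \<in> carrier_mat n n"
    by (intro minus_carrier_mat) simp
  have "det (1\<^sub>m n - A) \<noteq> 0"
  proof
    assume "det (1\<^sub>m n - A) = 0"
    then obtain x where x: "x \<in> carrier_vec n" "x \<noteq> 0\<^sub>v n" "(1\<^sub>m n - A) *\<^sub>v x = 0\<^sub>v n"
      using det_0_iff_vec_prod_zero_field[OF c] by auto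
    then have "x - A *\<^sub>v x = 0\<^sub>v n"
      using minus_mult_distrib_mat_vec[of "1\<^sub>m n" n n A x] by simp
    then have "(x - A *\<^sub>v x) $ k = 0" if "k < n" for k
      using that by simp
    then have "A *\<^sub>v x = x"
      using x(1) by (intro eq_vecI) auto
    then show False
      using fixed_vec_eq_0 x by blast
  qed
  then have "1\<^sub>m n - A \<in> Units (ring_mat TYPE(real) n ())"
    by (rule det_non_zero_imp_unit[OF c])
  then obtain R' where "mat_inverse (1\<^sub>m n - A) = Some R'"
    using mat_inverse(1)[OF c, where b = "()"] by (cases "mat_inverse (1\<^sub>m n - A)") auto
  then have "mat_inverse (1\<^sub>m n - A) = Some R"
    by (simp add: R_def)
  from mat_inverse(2)[OF c this]
  show "R \<in> carrier_mat n n" "(1\<^sub>m n - A) * R = 1\<^sub>m n" "R * (1\<^sub>m n - A) = 1\<^sub>m n"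
    by auto
qed

lemma invertible: "invertible_mat (1\<^sub>m n - A)"
  unfolding invertible_mat_def inverts_mat_def
  using mult_R R_mult R_carrier by (auto intro!: exI[of _ R])

text \<open>The solution operator of the discrete Dirichlet problem: it extends terminal values
  harmonically to the non-terminal nodes, see \<open>X_fixed_vec\<close>.\<close>

definition "X \<equiv> R * B"

lemma X_carrier [simp]: "X \<in> carrier_mat n t"
  unfolding X_def using R_carrier by (intro mult_carrier_mat) auto

lemma dim_X [simp]: "dim_row X = n" "dim_col X = t"
  using carrier_matD[OF X_carrier] by simp_all

lemma X_eq: "X - A * X = B"
proof -
  have "X - A * X = (1\<^sub>m n - A) * X"
    using minus_mult_distrib_mat[of "1\<^sub>m n" n n A X t] left_mult_one_mat[OF X_carrier] by simp
  also have "\<dots> = ((1\<^sub>m n - A) * R) * B"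
    unfolding X_def using R_carrier by (intro assoc_mult_mat[symmetric]) auto
  finally show ?thesis
    using mult_R left_mult_one_mat[of B n t] by simp
qed

section \<open>Powers of A tend to zero\<close>

lemma pow_A_carrier [simp]: "A ^\<^sub>m s \<in> carrier_mat n n"
  by simp

lemma pow_Suc_left: "A ^\<^sub>m Suc s = A * A ^\<^sub>m s"
proof (induction s)
  case (Suc s)
  then have "A ^\<^sub>m Suc (Suc s) = (A * A ^\<^sub>m s) * A"
    by simp
  also have "\<dots> = A * (A ^\<^sub>m s * A)"
    by (rule assoc_mult_mat) auto
  finally show ?case
    by simp
qed simp

text \<open>The first expansion gives nonnegativity and the decrease of the row sums, the second the
  recursion that passes to their limit.\<close>

lemma index_pow_A_Suc:
  assumes "i < n" "j < n"
  shows "(A ^\<^sub>m Suc s) $$ (i, j) = (\<Sum>k<n. (A ^\<^sub>m s) $$ (i, k) * A $$ (k, j))"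
    and "(A ^\<^sub>m Suc s) $$ (i, j) = (\<Sum>k<n. A $$ (i, k) * (A ^\<^sub>m s) $$ (k, j))"
proof -
  show "(A ^\<^sub>m Suc s) $$ (i, j) = (\<Sum>k<n. (A ^\<^sub>m s) $$ (i, k) * A $$ (k, j))"
    using assms by (simp add: scalar_prod_def lessThan_atLeast0)
  show "(A ^\<^sub>m Suc s) $$ (i, j) = (\<Sum>k<n. A $$ (i, k) * (A ^\<^sub>m s) $$ (k, j))"
    unfolding pow_Suc_left using assms by (simp add: scalar_prod_def lessThan_atLeast0)
qed

lemma pow_A_nonneg:
  assumes "i < n" "j < n"
  shows "0 \<le> (A ^\<^sub>m s) $$ (i, j)"
  using assms
proof (induction s arbitrary: j)
  case (Suc s)
  then show ?case
    unfolding index_pow_A_Suc(1)[OF Suc.prems]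
    by (intro sum_nonneg mult_nonneg_nonneg) (auto simp: propagation_entry_nonneg)
qed simp

lemma A_row_sum_le:
  assumes "k < n"
  shows "(\<Sum>j<n. A $$ (k, j)) \<le> 1"
proof -
  have "(\<Sum>j<n. A $$ (k, j)) = (\<Sum>a\<in>set ns. propagation_entry G (ns ! k) a)"
    using assms by (simp flip: sum_nth_distinct[OF distinct_ns])
  also have "\<dots> \<le> (\<Sum>a\<in>verts G. propagation_entry G (ns ! k) a)"
    by (intro sum_mono2) (auto simp: verts_lists propagation_entry_nonneg)
  finally show ?thesis
    using propagation_row_sum_le[OF non_terminal_nth[OF assms]] by simp
qed

lemma pow_A_tendsto_0:
  assumes "i < n" "j < n"
  shows "(\<lambda>s. (A ^\<^sub>m s) $$ (i, j)) \<longlonglongrightarrow> 0"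
proof -
  \<comment> \<open>\<open>r s\<close> is A^s applied to the all-ones vector.\<close>
  define r where "r s k = (\<Sum>j<n. (A ^\<^sub>m s) $$ (k, j))" for s k
  have r_nonneg: "0 \<le> r s k" if "k < n" for s k
    unfolding r_def using that by (intro sum_nonneg pow_A_nonneg) auto
  have dec: "r (Suc s) k \<le> r s k" if k: "k < n" for s k
  proof -
    have "r (Suc s) k = (\<Sum>j<n. \<Sum>l<n. (A ^\<^sub>m s) $$ (k, l) * A $$ (l, j))"
      unfolding r_def using k by (intro sum.cong refl index_pow_A_Suc(1)) auto
    also have "\<dots> = (\<Sum>l<n. \<Sum>j<n. (A ^\<^sub>m s) $$ (k, l) * A $$ (l, j))"
      by (rule sum.swap)
    also have "\<dots> = (\<Sum>l<n. (A ^\<^sub>m s) $$ (k, l) * (\<Sum>j<n. A $$ (l, j)))"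
      by (simp only: sum_distrib_left)
    also have "\<dots> \<le> (\<Sum>l<n. (A ^\<^sub>m s) $$ (k, l) * 1)"
      using k by (intro sum_mono mult_left_mono A_row_sum_le pow_A_nonneg) auto
    finally show ?thesis
      by (simp add: r_def)
  qed
  have rec: "r (Suc s) k = (\<Sum>l<n. A $$ (k, l) * r s l)" if k: "k < n" for s k
  proof -
    have "r (Suc s) k = (\<Sum>j<n. \<Sum>l<n. A $$ (k, l) * (A ^\<^sub>m s) $$ (l, j))"
      unfolding r_def using k by (intro sum.cong refl index_pow_A_Suc(2)) auto
    also have "\<dots> = (\<Sum>l<n. \<Sum>j<n. A $$ (k, l) * (A ^\<^sub>m s) $$ (l, j))"
      by (rule sum.swap)
    finally show ?thesis
      by (simp only: r_def sum_distrib_left)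
  qed
  \<comment> \<open>\<open>lim\<close> is a genuine limit here, since each sequence of row sums is
    decreasing and bounded below by 0.\<close>
  define x where "x = vec n (\<lambda>k. lim (\<lambda>s. r s k))"
  have lim: "(\<lambda>s. r s k) \<longlonglongrightarrow> x $ k" if k: "k < n" for k
  proof -
    have "convergent (\<lambda>s. r s k)"
      using decseq_convergent[of "\<lambda>s. r s k" 0] dec[OF k] r_nonneg[OF k]
      by (metis convergentI decseq_SucI)
    then show ?thesis
      using k by (simp add: x_def convergent_LIMSEQ_iff)
  qed
  have "A *\<^sub>v x = x"
  proof (rule eq_vecI)
    fix k assume "k < dim_vec x"
    then have k: "k < n"
      by (simp add: x_def)
    \<comment> \<open>Letting s tend to infinity in \<open>rec\<close> shows that \<open>x\<close>
      is fixed by \<open>A\<close>.\<close>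
    have "(\<lambda>s. \<Sum>l<n. A $$ (k, l) * r s l) \<longlonglongrightarrow> (\<Sum>l<n. A $$ (k, l) * x $ l)"
      by (intro tendsto_intros lim) auto
    then have "(\<lambda>s. r (Suc s) k) \<longlonglongrightarrow> (\<Sum>l<n. A $$ (k, l) * x $ l)"
      by (simp only: rec[OF k])
    moreover have "(\<lambda>s. r (Suc s) k) \<longlonglongrightarrow> x $ k"
      using lim[OF k] by (rule LIMSEQ_Suc)
    ultimately have "(\<Sum>l<n. A $$ (k, l) * x $ l) = x $ k"
      by (rule LIMSEQ_unique)
    then show "(A *\<^sub>v x) $ k = x $ k"
      using k by (simp add: scalar_prod_def lessThan_atLeast0 x_def)
  qed (simp add: x_def)
  then have "x = 0\<^sub>v n"
    by (intro fixed_vec_eq_0) (simp_all add: x_def)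
  then have r0: "(\<lambda>s. r s i) \<longlonglongrightarrow> 0"
    using lim[OF assms(1)] assms(1) by simp
  \<comment> \<open>By nonnegativity each entry lies between 0 and its row sum.\<close>
  have "(A ^\<^sub>m s) $$ (i, j) \<le> r s i" for s
    unfolding r_def using assms by (intro member_le_sum) (auto intro: pow_A_nonneg)
  then show ?thesis
    using assms by (intro tendsto_sandwich[OF _ _ tendsto_const r0]) (auto simp: pow_A_nonneg)
qed

section \<open>Powers of M and their limit\<close>

lemma pow_M: "M ^\<^sub>m s = four_block_mat (A ^\<^sub>m s) (X - A ^\<^sub>m s * X) (0\<^sub>m t n) (1\<^sub>m t)"
proof (induction s)
  case 0
  have "X - 1\<^sub>m n * X = 0\<^sub>m n t"
    by (intro eq_matI) auto
  then show ?case
    by (simp del: left_mult_one_mat')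
next
  case (Suc s)
  have AX: "A ^\<^sub>m s * X \<in> carrier_mat n t" "A * X \<in> carrier_mat n t"
    "A ^\<^sub>m s * (A * X) \<in> carrier_mat n t"
    by (meson mult_carrier_mat pow_A_carrier X_carrier propagation_mat_carrier(1))+
  \<comment> \<open>Substituting B = X - A X makes the contribution of each new factor a difference
    of consecutive terms A^s X, so the upper right block telescopes.\<close>
  have "A ^\<^sub>m s * B = A ^\<^sub>m s * X - A ^\<^sub>m s * (A * X)"
    using mult_minus_distrib_mat[OF pow_A_carrier X_carrier AX(2), of s] X_eq by simp
  also have "A ^\<^sub>m s * (A * X) = A ^\<^sub>m Suc s * X"
    using assoc_mult_mat[of "A ^\<^sub>m s" n n A n X t] by simp
  finally have B: "A ^\<^sub>m s * B = A ^\<^sub>m s * X - A ^\<^sub>m Suc s * X" .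
  have D: "X - A ^\<^sub>m s * X \<in> carrier_mat n t"
    using AX by (intro minus_carrier_mat)
  have "A ^\<^sub>m Suc s * X \<in> carrier_mat n t"
    by (intro mult_carrier_mat[of _ n n]) (simp_all del: pow_mat.simps)
  then have telescope: "A ^\<^sub>m s * B + (X - A ^\<^sub>m s * X) = X - A ^\<^sub>m Suc s * X"
    unfolding B using AX(1) X_carrier
    by (intro eq_matI) (auto simp del: pow_mat.simps index_mult_mat(1))
  have "M ^\<^sub>m Suc s = four_block_mat (A ^\<^sub>m s) (X - A ^\<^sub>m s * X) (0\<^sub>m t n) (1\<^sub>m t)
      * four_block_mat A B (0\<^sub>m t n) (1\<^sub>m t)"
    using Suc M_blocks by simp
  also have "\<dots> = four_block_mat (A ^\<^sub>m s * A + (X - A ^\<^sub>m s * X) * 0\<^sub>m t n)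
      (A ^\<^sub>m s * B + (X - A ^\<^sub>m s * X) * 1\<^sub>m t)
      (0\<^sub>m t n * A + 1\<^sub>m t * 0\<^sub>m t n) (0\<^sub>m t n * B + 1\<^sub>m t * 1\<^sub>m t)"
    by (rule mult_four_block_mat[OF pow_A_carrier D]) auto
  also have "\<dots> = four_block_mat (A ^\<^sub>m Suc s) (X - A ^\<^sub>m Suc s * X) (0\<^sub>m t n) (1\<^sub>m t)"
    using right_mult_one_mat[OF D] right_mult_zero_mat[OF D]
      left_mult_zero_mat[OF propagation_mat_carrier(1)]
      right_add_zero_mat[OF pow_A_carrier[of "Suc s"]] telescope
    by simp
  finally show ?case .
qed

lemma pow_M_limit:
  "mat_LIMSEQ (\<lambda>s. M ^\<^sub>m s) (four_block_mat (0\<^sub>m n n) X (0\<^sub>m t n) (1\<^sub>m t))"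
proof -
  have upper_right: "(\<lambda>s. (X - A ^\<^sub>m s * X) $$ (i, j)) \<longlonglongrightarrow> X $$ (i, j)"
    if ij: "i < n" "j < t" for i j
  proof -
    have "(\<lambda>s. X $$ (i, j) - (\<Sum>k<n. (A ^\<^sub>m s) $$ (i, k) * X $$ (k, j)))
        \<longlonglongrightarrow> X $$ (i, j) - (\<Sum>k<n. 0 * X $$ (k, j))"
      using ij by (intro tendsto_intros pow_A_tendsto_0) auto
    moreover have "(X - A ^\<^sub>m s * X) $$ (i, j) =
        X $$ (i, j) - (\<Sum>k<n. (A ^\<^sub>m s) $$ (i, k) * X $$ (k, j))" for s
      using ij by (simp add: scalar_prod_def lessThan_atLeast0)
    ultimately show ?thesis
      by simp
  qed
  show ?thesis
    unfolding mat_LIMSEQ_def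
  proof (intro conjI allI impI)
    fix i j
    assume "i < dim_row (four_block_mat (0\<^sub>m n n) X (0\<^sub>m t n) (1\<^sub>m t))"
      and "j < dim_col (four_block_mat (0\<^sub>m n n) X (0\<^sub>m t n) (1\<^sub>m t))"
    then have ij: "i < n + t" "j < n + t"
      by simp_all
    \<comment> \<open>Only the two upper blocks vary with s; the lower rows already agree with the
      limit for every s.\<close>
    have entry: "(M ^\<^sub>m s) $$ (i, j) =
        (if i < n \<and> j < n then (A ^\<^sub>m s) $$ (i, j)
         else if i < n then (X - A ^\<^sub>m s * X) $$ (i, j - n)
         else four_block_mat (0\<^sub>m n n) X (0\<^sub>m t n) (1\<^sub>m t) $$ (i, j))" for s
      unfolding pow_M
      using ij carrier_matD[OF pow_A_carrier, of s] by (cases "i < n"; cases "j < n") simp_all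
    show "(\<lambda>s. (M ^\<^sub>m s) $$ (i, j))
        \<longlonglongrightarrow> four_block_mat (0\<^sub>m n n) X (0\<^sub>m t n) (1\<^sub>m t) $$ (i, j)"
      unfolding entry using ij pow_A_tendsto_0[of i j] upper_right[of i "j - n"]
      by (cases "i < n"; cases "j < n") (simp_all del: index_minus_mat(1))
  next
    fix s
    have "M \<in> carrier_mat (n + t) (n + t)"
      using propagation_mat_carrier(1)[of G "ns @ ts" "ns @ ts"] by simp
    then have "M ^\<^sub>m s \<in> carrier_mat (n + t) (n + t)"
      by (rule pow_carrier_mat)
    then show "M ^\<^sub>m s \<in> carrier_mat (dim_row (four_block_mat (0\<^sub>m n n) X (0\<^sub>m t n) (1\<^sub>m t)))
        (dim_col (four_block_mat (0\<^sub>m n n) X (0\<^sub>m t n) (1\<^sub>m t)))"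
      by simp
  qed
qed

section \<open>The harmonic extension and its positivity\<close>

lemma X_fixed_vec:
  assumes "y \<in> carrier_vec t"
  shows "A *\<^sub>v (X *\<^sub>v y) + B *\<^sub>v y = X *\<^sub>v y"
proof -
  have AX: "A * X \<in> carrier_mat n t"
    by (rule mult_carrier_mat[OF propagation_mat_carrier(1) X_carrier])
  have "A * X + B = X"
    by (subst X_eq[symmetric], intro eq_matI) (auto simp del: index_mult_mat(1))
  then have "X *\<^sub>v y = (A * X + B) *\<^sub>v y"
    by simp
  also have "\<dots> = (A * X) *\<^sub>v y + B *\<^sub>v y"
    by (rule add_mult_distrib_mat_vec[OF AX propagation_mat_carrier(1) assms])
  also have "(A * X) *\<^sub>v y = A *\<^sub>v (X *\<^sub>v y)"
    by (rule assoc_mult_mat_vec[OF propagation_mat_carrier(1) X_carrier assms])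
  finally show ?thesis
    by simp
qed

lemma X_mult_vec_pos:
  assumes y: "y \<in> carrier_vec t" "\<And>l. l < t \<Longrightarrow> 0 < y $ l"
    and k: "k < n"
  shows "0 < (X *\<^sub>v y) $ k"
proof (rule ccontr)
  define x where "x = X *\<^sub>v y"
  assume "\<not> ?thesis"
  then have neg: "x $ k \<le> 0"
    unfolding x_def by (rule leI)
  have x: "x \<in> carrier_vec n"
    unfolding x_def by (rule mult_mat_vec_carrier[OF X_carrier y(1)])
  have eq: "x = A *\<^sub>v x + B *\<^sub>v y"
    unfolding x_def using X_fixed_vec[OF y(1)] by simp
  \<comment> \<open>Since -x is nonnegative at \<open>k\<close>, the maximum principle yields a
    terminal \<open>l\<close> with y_l \<le> x_k \<le> 0, against the positivity of
    \<open>y\<close>.\<close>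
  have "\<exists>l<t. (- x) $ k \<le> (- y) $ l"
  proof (rule maximum_principle_vec)
    fix j assume j: "j < n"
    have "x $ j = (A *\<^sub>v x) $ j + (B *\<^sub>v y) $ j"
      using arg_cong[OF eq, of "\<lambda>v. v $ j"] j by simp
    then show "(- x) $ j \<le> (A *\<^sub>v (- x)) $ j + (B *\<^sub>v (- y)) $ j"
      using x y(1) j by simp
  qed (use x y(1) k neg in simp_all)
  then obtain l where l: "l < t" "(- x) $ k \<le> (- y) $ l"
    by blast
  then have "y $ l \<le> x $ k"
    using x y(1) k by simp
  then show False
    using neg y(2)[OF l(1)] by simp
qed

end

section \<open>The limiting reciprocal value vector\<close>

lemma mat_LIMSEQ_mult_vec:
  assumes "mat_LIMSEQ Y L" "w \<in> carrier_vec (dim_col L)"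
  shows "vec_LIMSEQ (\<lambda>s. Y s *\<^sub>v w) (L *\<^sub>v w)"
proof -
  have Y: "Y s \<in> carrier_mat (dim_row L) (dim_col L)" for s
    using assms(1) by (simp add: mat_LIMSEQ_def)
  have "(\<lambda>s. (Y s *\<^sub>v w) $ i) \<longlonglongrightarrow> (L *\<^sub>v w) $ i" if i: "i < dim_row L" for i
  proof -
    have "(\<lambda>s. \<Sum>j<dim_col L. Y s $$ (i, j) * w $ j) \<longlonglongrightarrow> (\<Sum>j<dim_col L. L $$ (i, j) * w $ j)"
      using assms(1) i by (intro tendsto_intros) (auto simp: mat_LIMSEQ_def)
    moreover have "(Y s *\<^sub>v w) $ i = (\<Sum>j<dim_col L. Y s $$ (i, j) * w $ j)" for s
      using Y[of s] assms(2) i by (auto simp: scalar_prod_def lessThan_atLeast0)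
    ultimately show ?thesis
      using assms(2) i by (simp add: scalar_prod_def lessThan_atLeast0)
  qed
  then show ?thesis
    using carrier_matD(1)[OF Y] by (auto simp: vec_LIMSEQ_def intro: carrier_vecI)
qed

theorem lemma1:
  fixes G :: "('a, 'b) pre_digraph"
    and ns ts :: "'a list"
    and v :: "'a \<Rightarrow> real"
    and N_nt N_t :: nat
    and M A B :: "real mat"
    and u_t u_0 :: "real vec"
  assumes "terminating_graph G"
    and "distinct ns" and "set ns = {i. non_terminal G i}"
    and "distinct ts" and "set ts = {j. terminal G j}"
    and "\<And>j. terminal G j \<Longrightarrow> v j > 0"
  defines "N_nt \<equiv> length ns"
    and "N_t \<equiv> length ts"
    and "M \<equiv> propagation_mat G (ns @ ts) (ns @ ts)"
    and "A \<equiv> propagation_mat G ns ns"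
    and "B \<equiv> propagation_mat G ns ts"
    and "u_t \<equiv> vec N_t (\<lambda>j. inverse (v (ts ! j)))"
    and "u_0 \<equiv> vec N_nt (\<lambda>_. 1) @\<^sub>v u_t"
  shows "M = four_block_mat A B (0\<^sub>m N_t N_nt) (1\<^sub>m N_t) \<and>
    invertible_mat (1\<^sub>m N_nt - A) \<and>
    mat_LIMSEQ (\<lambda>s. M ^\<^sub>m s)
      (four_block_mat (0\<^sub>m N_nt N_nt) (the (mat_inverse (1\<^sub>m N_nt - A)) * B)
                      (0\<^sub>m N_t N_nt) (1\<^sub>m N_t)) \<and>
    (\<exists>u. vec_LIMSEQ (\<lambda>s. (M ^\<^sub>m s) *\<^sub>v u_0) u \<and>
         M *\<^sub>v u = u \<and>
         (\<forall>i < dim_vec u. u $ i > 0) \<and>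
         u = vec_first u N_nt @\<^sub>v u_t \<and>
         vec_first u N_nt = (the (mat_inverse (1\<^sub>m N_nt - A)) * B) *\<^sub>v u_t)"
proof -
  interpret terminating_graph G by fact
  interpret numbered_terminating_graph G ns ts
    by unfold_locales fact+
  note local_defs = N_nt_def N_t_def M_def A_def B_def
  have X: "the (mat_inverse (1\<^sub>m (length ns) - propagation_mat G ns ns)) * propagation_mat G ns ts = X"
    by (simp add: X_def R_def)
  have ut: "u_t \<in> carrier_vec (length ts)"
    by (simp add: u_t_def N_t_def)
  \<comment> \<open>The candidate limit is the harmonic extension of the terminal
    reciprocals.\<close>
  define u where "u = (X *\<^sub>v u_t) @\<^sub>v u_t"
  have Xu: "X *\<^sub>v u_t \<in> carrier_vec (length ns)"
    using ut by (rule mult_mat_vec_carrier[OF X_carrier])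
  \<comment> \<open>Used with P = 0 for the limit matrix and with P = A for
    \<open>M\<close>.\<close>
  have block_mult: "four_block_mat P Q (0\<^sub>m t n) (1\<^sub>m t) *\<^sub>v (a @\<^sub>v u_t)
      = (P *\<^sub>v a + Q *\<^sub>v u_t) @\<^sub>v u_t"
    if "P \<in> carrier_mat n n" "Q \<in> carrier_mat n t" "a \<in> carrier_vec n" for P Q :: "real mat" and a
  proof -
    have "0\<^sub>m t n *\<^sub>v a + 1\<^sub>m t *\<^sub>v u_t = u_t"
      using that(3) ut by (intro eq_vecI) auto
    then show ?thesis
      using four_block_mat_mult_vec[OF that(1,2) zero_carrier_mat one_carrier_mat that(3) ut]
      by simp
  qed
  \<comment> \<open>The zero upper left block erases the all-ones part of \<open>u_0\<close>, so the
    limit depends on \<open>u_t\<close> alone.\<close>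
  have "four_block_mat (0\<^sub>m n n) X (0\<^sub>m t n) (1\<^sub>m t) *\<^sub>v u_0 = u"
    unfolding u_0_def N_nt_def u_def using Xu
    by (subst block_mult) (auto)
  moreover have "u_0 \<in> carrier_vec (n + t)"
    unfolding u_0_def N_nt_def using ut by (intro append_carrier_vec) auto
  ultimately have "vec_LIMSEQ (\<lambda>s. (M ^\<^sub>m s) *\<^sub>v u_0) u"
    unfolding M_def using mat_LIMSEQ_mult_vec[OF pow_M_limit, of u_0] by simp
  moreover have "M *\<^sub>v u = u"
    unfolding M_def M_blocks u_def
    by (subst block_mult) (simp_all add: Xu X_fixed_vec[OF ut])
  moreover have "\<forall>i<dim_vec u. u $ i > 0"
  proof (intro allI impI)
    fix i assume i: "i < dim_vec u"
    have pos: "0 < u_t $ l" if "l < t" for l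
      using that assms(6)[OF terminal_nth[OF that]] by (simp add: u_t_def N_t_def)
    show "u $ i > 0"
      using i Xu ut pos[of "i - n"] X_mult_vec_pos[OF ut pos, of i]
      by (cases "i < n") (auto simp: u_def simp del: index_mult_mat_vec)
  qed
  moreover have first: "vec_first u N_nt = X *\<^sub>v u_t"
    unfolding u_def N_nt_def vec_first_def using Xu
    by (intro eq_vecI) (auto simp del: index_mult_mat_vec)
  moreover have "u = vec_first u N_nt @\<^sub>v u_t"
    unfolding first by (simp add: u_def)
  ultimately show ?thesis
    unfolding local_defs X using M_blocks invertible pow_M_limit by blast
qed

end
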